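(* Let $n\ge3$ and let $\Upsilon:VST_n\to\mathrm{GL}_n(\mathbb{C})$ be a complex homogeneous $2$-local representation of the virtual singular twin group $VST_n$. Then $\Upsilon$ is equivalent to one of the following six representations $\Upsilon_j:VST_n\to\mathrm{GL}_n(\mathbb{C})$, $1\le j\le6$, where for $1\le i\le n-1$ the matrices $\Upsilon_j(s_i),\Upsilon_j(\tau_i),\Upsilon_j(\nu_i)$ are block diagonal with diagonal blocks $(I_{i-1},S_j,I_{n-i-1})$, $(I_{i-1},T_j,I_{n-i-1})$, $(I_{i-1},V_j,I_{n-i-1})$ respectively: (1) $S_1=\begin{pmatrix}0&b\\\frac1b&0\end{pmatrix}$, $T_1=\begin{pmatrix}x&y\\\frac{y}{b^2}&x\end{pmatrix}$, $V_1=\begin{pmatrix}0&v\\\frac1v&0\end{pmatrix}$, where $b,x,y,v\in\mathbb{C}$, $b\ne0$, $x^2-\frac{y^2}{b^2}\neq0$, $v\ne0$. (2) $S_2=\begin{pmatrix}-\sqrt{1-bc}&b\\c&\sqrt{1-bc}\end{pmatrix}$, $T_2=\begin{pmatrix}1&0\\0&1\end{pmatrix}$, $V_2=\begin{pmatrix}0&v\\\frac1v&0\end{pmatrix}$, where $b,c,v\in\mathbb{C}$, $v\ne0$. (3) $S_3=\begin{pmatrix}\sqrt{1-bc}&b\\c&-\sqrt{1-bc}\end{pmatrix}$, $T_3=\begin{pmatrix}1&0\\0&1\end{pmatrix}$, $V_3=\begin{pmatrix}0&v\\\frac1v&0\end{pmatrix}$, where $b,c,v\in\mathbb{C}$, $v\ne0$.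 (4) $S_4=\begin{pmatrix}-1&0\\0&-1\end{pmatrix}$, $T_4=\begin{pmatrix}1&0\\0&1\end{pmatrix}$, $V_4=\begin{pmatrix}0&v\\\frac1v&0\end{pmatrix}$, where $v\in\mathbb{C}$, $v\ne0$. (5) $S_5=\begin{pmatrix}1&0\\0&1\end{pmatrix}$, $T_5=\begin{pmatrix}1&0\\0&1\end{pmatrix}$, $V_5=\begin{pmatrix}0&v\\\frac1v&0\end{pmatrix}$, where $v\in\mathbb{C}$, $v\ne0$. (6) $S_6=T_6=V_6=\begin{pmatrix}1&0\\0&1\end{pmatrix}$.
   Context: The virtual singular twin group $VST_n$ is the group generated by $s_i,\tau_i,\nu_i$ ($1\le i\le n-1$) subject to: $s_i^2=1$, $\nu_i^2=1$ and $\tau_is_i=s_i\tau_i$ for all $i$; $s_is_j\tau_i=\tau_js_is_j$, $\nu_i\nu_j\nu_i=\nu_j\nu_i\nu_j$, $\nu_is_j\nu_i=\nu_js_i\nu_j$, $\nu_i\tau_j\nu_i=\nu_j\tau_i\nu_j$ for $|i-j|=1$; and $g_ih_j=h_jg_i$ for $|i-j|\ge 2$, where $g_i,h_i\in\{s_i,\tau_i,\nu_i\}$. A representation $\Upsilon:VST_n\to \mathrm{GL}_n(\mathbb{C})$ is complex homogeneous $2$-local if there are matrices $S,T,V\in\mathrm{GL}_2(\mathbb{C})$, independent of $i$, such that for all $1\le i\le n-1$ the matrices $\Upsilon(s_i),\Upsilon(\tau_i),\Upsilon(\nu_i)$ are block diagonal with diagonal blocks $(I_{i-1},S,I_{n-i-1})$,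 $(I_{i-1},T,I_{n-i-1})$, $(I_{i-1},V,I_{n-i-1})$ respectively. $I_r$ is the $r\times r$ identity matrix, and $\sqrt{1-bc}$ denotes a chosen complex square root of $1-bc$. Two representations are equivalent if they are conjugate by an element of $\mathrm{GL}_n(\mathbb{C})$. *)

theory Defs
  imports "Jordan_Normal_Form.Matrix" "HOL-Algebra.Group"
begin

section \<open>Groups given by generators and relations\<close>

text \<open>A letter \<open>(g, False)\<close> stands for the generator \<open>g\<close> and \<open>(g, True)\<close> for its formal inverse.
  A relation \<open>u = v\<close> is given as the pair of words \<open>(u, v)\<close>.\<close>

type_synonym 'g word = "('g \<times> bool) list"

definition words_over :: "'g set \<Rightarrow> 'g word set" where
  "words_over X = lists (X \<times> UNIV)"

inductive pres_eq :: "'g set \<Rightarrow> ('g word \<times> 'g word) set \<Rightarrow> 'g word \<Rightarrow> 'g word \<Rightarrow> bool"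
  for X R where
  refl: "w \<in> words_over X \<Longrightarrow> pres_eq X R w w"
| sym: "pres_eq X R u v \<Longrightarrow> pres_eq X R v u"
| trans: "pres_eq X R u v \<Longrightarrow> pres_eq X R v w \<Longrightarrow> pres_eq X R u w"
| append: "pres_eq X R u u' \<Longrightarrow> pres_eq X R v v' \<Longrightarrow> pres_eq X R (u @ v) (u' @ v')"
| cancel: "g \<in> X \<Longrightarrow> pres_eq X R [(g, e), (g, \<not> e)] []"
| relator: "(u, v) \<in> R \<Longrightarrow> u \<in> words_over X \<Longrightarrow> v \<in> words_over X \<Longrightarrow> pres_eq X R u v"

definition word_class :: "'g set \<Rightarrow> ('g word \<times> 'g word) set \<Rightarrow> 'g word \<Rightarrow> 'g word set" where
  "word_class X R w = {w'. pres_eq X R w w'}"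

definition presented_group :: "'g set \<Rightarrow> ('g word \<times> 'g word) set \<Rightarrow> 'g word set monoid" where
  "presented_group X R =
    \<lparr>carrier = word_class X R ` words_over X,
     mult = (\<lambda>A B. \<Union>u\<in>A. \<Union>v\<in>B. word_class X R (u @ v)),
     one = word_class X R []\<rparr>"

definition pos_word :: "'g list \<Rightarrow> 'g word" where
  "pos_word gs = map (\<lambda>g. (g, False)) gs"

definition pres_gen :: "'g set \<Rightarrow> ('g word \<times> 'g word) set \<Rightarrow> 'g \<Rightarrow> 'g word set" where
  "pres_gen X R g = word_class X R (pos_word [g])"

lemma words_over_append [simp]:
  "u @ v \<in> words_over X \<longleftrightarrow> u \<in> words_over X \<and> v \<in> words_over X"
  by (auto simp: words_over_def)

lemma words_over_Nil [simp]: "[] \<in> words_over X"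
  by (simp add: words_over_def)

lemma words_over_Cons [simp]: "a # w \<in> words_over X \<longleftrightarrow> fst a \<in> X \<and> w \<in> words_over X"
  by (cases a) (auto simp: words_over_def)

lemma pres_eq_words: "pres_eq X R u v \<Longrightarrow> u \<in> words_over X \<and> v \<in> words_over X"
  by (induction rule: pres_eq.induct) auto

lemma word_class_eq_iff:
  "u \<in> words_over X \<Longrightarrow> v \<in> words_over X \<Longrightarrow>
    word_class X R u = word_class X R v \<longleftrightarrow> pres_eq X R u v"
  using pres_eq.refl pres_eq.sym pres_eq.trans unfolding word_class_def set_eq_iff mem_Collect_eq
  by metis

lemma presented_group_mult:
  assumes "u \<in> words_over X" "v \<in> words_over X"
  shows "word_class X R u \<otimes>\<^bsub>presented_group X R\<^esub> word_class X R v = word_class X R (u @ v)"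
proof -
  have "word_class X R (u' @ v') = word_class X R (u @ v)"
    if "u' \<in> word_class X R u" "v' \<in> word_class X R v" for u' v'
  proof -
    have "pres_eq X R (u @ v) (u' @ v')"
      using that by (auto simp: word_class_def intro: pres_eq.append)
    with pres_eq_words[OF this] show ?thesis
      by (simp only: word_class_eq_iff pres_eq.sym)
  qed
  moreover have "u \<in> word_class X R u" "v \<in> word_class X R v"
    using assms by (auto simp: word_class_def intro: pres_eq.refl)
  ultimately have "(\<Union>u'\<in>word_class X R u. \<Union>v'\<in>word_class X R v. word_class X R (u' @ v')) =
      word_class X R (u @ v)"
    by blast
  then show ?thesis
    by (simp add: presented_group_def)
qed

definition inv_word :: "'g word \<Rightarrow> 'g word" where
  "inv_word w = rev (map (\<lambda>(g, e). (g, \<not> e)) w)"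

lemma inv_word_words: "w \<in> words_over X \<Longrightarrow> inv_word w \<in> words_over X"
  by (induction w) (auto simp: inv_word_def)

lemma pres_eq_inv_word: "w \<in> words_over X \<Longrightarrow> pres_eq X R (inv_word w @ w) []"
proof (induction w)
  case Nil
  then show ?case by (simp add: inv_word_def pres_eq.refl)
next
  case (Cons a w)
  obtain g e where a: "a = (g, e)" by (cases a)
  have w: "w \<in> words_over X" "g \<in> X" using Cons.prems a by auto
  have c: "pres_eq X R [(g, \<not> e), (g, e)] []"
    using pres_eq.cancel[of g X R "\<not> e"] w by simp
  have "pres_eq X R (inv_word w @ ([(g, \<not> e), (g, e)] @ w)) (inv_word w @ ([] @ w))"
    by (intro pres_eq.append pres_eq.refl c w inv_word_words)
  then have "pres_eq X R (inv_word (a # w) @ a # w) (inv_word w @ w)"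
    by (simp add: a inv_word_def)
  then show ?case using Cons.IH w pres_eq.trans by blast
qed

lemma group_presented_group: "group (presented_group X R)"
proof (rule groupI)
  fix A assume "A \<in> carrier (presented_group X R)"
  then obtain w where w: "w \<in> words_over X" "A = word_class X R w"
    by (auto simp: presented_group_def)
  have one: "\<one>\<^bsub>presented_group X R\<^esub> = word_class X R []"
    by (simp add: presented_group_def)
  show "\<one>\<^bsub>presented_group X R\<^esub> \<otimes>\<^bsub>presented_group X R\<^esub> A = A"
    using w by (simp add: one presented_group_mult)
  have "word_class X R (inv_word w) \<otimes>\<^bsub>presented_group X R\<^esub> A = \<one>\<^bsub>presented_group X R\<^esub>"
    using w by (simp add: one presented_group_mult inv_word_words word_class_eq_iff
        pres_eq_inv_word)
  then show "\<exists>B\<in>carrier (presented_group X R).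
      B \<otimes>\<^bsub>presented_group X R\<^esub> A = \<one>\<^bsub>presented_group X R\<^esub>"
    using inv_word_words[OF w(1)] by (auto simp: presented_group_def)
next
  fix A B assume "A \<in> carrier (presented_group X R)" "B \<in> carrier (presented_group X R)"
  then obtain u v where "u \<in> words_over X" "A = word_class X R u"
      "v \<in> words_over X" "B = word_class X R v"
    by (auto simp: presented_group_def)
  moreover from this have "word_class X R (u @ v) \<in> carrier (presented_group X R)"
    by (simp add: presented_group_def)
  ultimately show "A \<otimes>\<^bsub>presented_group X R\<^esub> B \<in> carrier (presented_group X R)"
    by (simp add: presented_group_mult)
next
  fix A B C assume "A \<in> carrier (presented_group X R)" "B \<in> carrier (presented_group X R)"
    "C \<in> carrier (presented_group X R)"
  then obtain u v w where "u \<in> words_over X" "A = word_class X R u"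
      "v \<in> words_over X" "B = word_class X R v" "w \<in> words_over X" "C = word_class X R w"
    by (auto simp: presented_group_def)
  then show "A \<otimes>\<^bsub>presented_group X R\<^esub> B \<otimes>\<^bsub>presented_group X R\<^esub> C =
      A \<otimes>\<^bsub>presented_group X R\<^esub> (B \<otimes>\<^bsub>presented_group X R\<^esub> C)"
    by (simp add: presented_group_mult)
qed (simp add: presented_group_def)

lemma pres_gen_closed: "g \<in> X \<Longrightarrow> pres_gen X R g \<in> carrier (presented_group X R)"
  by (simp add: pres_gen_def presented_group_def pos_word_def)

fun eval_word :: "('a, 'b) monoid_scheme \<Rightarrow> ('g \<Rightarrow> 'a) \<Rightarrow> 'g word \<Rightarrow> 'a" where
  "eval_word G f [] = \<one>\<^bsub>G\<^esub>"
| "eval_word G f ((g, e) # w) = (if e then inv\<^bsub>G\<^esub> f g else f g) \<otimes>\<^bsub>G\<^esub> eval_word G f w"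

lemma presented_group_universal:
  assumes G: "group G" and f: "\<And>g. g \<in> X \<Longrightarrow> f g \<in> carrier G"
    and R: "\<And>u v. (u, v) \<in> R \<Longrightarrow> u \<in> words_over X \<Longrightarrow> v \<in> words_over X \<Longrightarrow>
      eval_word G f u = eval_word G f v"
  shows "\<exists>h \<in> hom (presented_group X R) G. \<forall>g\<in>X. h (pres_gen X R g) = f g"
proof -
  interpret group G by fact
  have closed: "eval_word G f w \<in> carrier G" if "w \<in> words_over X" for w
    using that by (induction w) (auto simp: f)
  have app: "eval_word G f (u @ v) = eval_word G f u \<otimes>\<^bsub>G\<^esub> eval_word G f v"
    if "u \<in> words_over X" "v \<in> words_over X" for u v
    using that by (induction u) (auto simp: closed f m_assoc)
  have eq: "eval_word G f u = eval_word G f v" if "pres_eq X R u v" for u v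
    using that
  proof (induction rule: pres_eq.induct)
    case (append u u' v v')
    then show ?case using pres_eq_words by (metis app)
  next
    case (cancel g e)
    then show ?case by (auto simp: f)
  qed (auto simp: R)
  define h where "h A = eval_word G f (SOME w. w \<in> A)" for A
  have h: "h (word_class X R w) = eval_word G f w" if "w \<in> words_over X" for w
  proof -
    have "w \<in> word_class X R w" using that by (simp add: word_class_def pres_eq.refl)
    then have "(SOME w'. w' \<in> word_class X R w) \<in> word_class X R w" by (rule someI)
    then show ?thesis unfolding h_def using eq by (auto simp: word_class_def)
  qed
  have "h \<in> hom (presented_group X R) G"
  proof (rule homI)
    fix A assume "A \<in> carrier (presented_group X R)"
    then show "h A \<in> carrier G"
      by (auto simp: presented_group_def h closed)
  next
    fix A B assume "A \<in> carrier (presented_group X R)" "B \<in> carrier (presented_group X R)"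
    then obtain u v where "u \<in> words_over X" "A = word_class X R u"
        "v \<in> words_over X" "B = word_class X R v"
      by (auto simp: presented_group_def)
    then show "h (A \<otimes>\<^bsub>presented_group X R\<^esub> B) = h A \<otimes>\<^bsub>G\<^esub> h B"
      by (simp add: presented_group_mult h app)
  qed
  moreover have "\<forall>g\<in>X. h (pres_gen X R g) = f g"
    by (simp add: pres_gen_def h pos_word_def f)
  ultimately show ?thesis by blast
qed

section \<open>The virtual singular twin group\<close>

datatype vst_gen = Sgen nat | Tgen nat | Vgen nat

definition vst_gens :: "nat \<Rightarrow> vst_gen set" where
  "vst_gens n = (\<Union>g\<in>{Sgen, Tgen, Vgen}. g ` {1..n - 1})"

abbreviation adjacent :: "nat \<Rightarrow> nat \<Rightarrow> nat \<Rightarrow> bool" where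
  "adjacent n i j \<equiv> i \<in> {1..n - 1} \<and> j \<in> {1..n - 1} \<and> \<bar>int i - int j\<bar> = 1"

abbreviation distant :: "nat \<Rightarrow> nat \<Rightarrow> nat \<Rightarrow> bool" where
  "distant n i j \<equiv> i \<in> {1..n - 1} \<and> j \<in> {1..n - 1} \<and> \<bar>int i - int j\<bar> \<ge> 2"

inductive_set vst_rels :: "nat \<Rightarrow> (vst_gen word \<times> vst_gen word) set" for n where
  "i \<in> {1..n - 1} \<Longrightarrow> (pos_word [Sgen i, Sgen i], []) \<in> vst_rels n"
| "i \<in> {1..n - 1} \<Longrightarrow> (pos_word [Vgen i, Vgen i], []) \<in> vst_rels n"
| "i \<in> {1..n - 1} \<Longrightarrow> (pos_word [Tgen i, Sgen i], pos_word [Sgen i, Tgen i]) \<in> vst_rels n"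
| "adjacent n i j \<Longrightarrow>
    (pos_word [Sgen i, Sgen j, Tgen i], pos_word [Tgen j, Sgen i, Sgen j]) \<in> vst_rels n"
| "adjacent n i j \<Longrightarrow>
    (pos_word [Vgen i, Vgen j, Vgen i], pos_word [Vgen j, Vgen i, Vgen j]) \<in> vst_rels n"
| "adjacent n i j \<Longrightarrow>
    (pos_word [Vgen i, Sgen j, Vgen i], pos_word [Vgen j, Sgen i, Vgen j]) \<in> vst_rels n"
| "adjacent n i j \<Longrightarrow>
    (pos_word [Vgen i, Tgen j, Vgen i], pos_word [Vgen j, Tgen i, Vgen j]) \<in> vst_rels n"
| "distant n i j \<Longrightarrow> g \<in> {Sgen, Tgen, Vgen} \<Longrightarrow> h \<in> {Sgen, Tgen, Vgen} \<Longrightarrow>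
    (pos_word [g i, h j], pos_word [h j, g i]) \<in> vst_rels n"

definition VST :: "nat \<Rightarrow> vst_gen word set monoid" where
  "VST n = presented_group (vst_gens n) (vst_rels n)"

definition vst_elem :: "nat \<Rightarrow> vst_gen \<Rightarrow> vst_gen word set" where
  "vst_elem n = pres_gen (vst_gens n) (vst_rels n)"

lemma group_VST: "group (VST n)"
  by (simp add: VST_def group_presented_group)

section \<open>Complex representations\<close>

abbreviation GL :: "nat \<Rightarrow> complex mat monoid" where
  "GL n \<equiv> units_of (ring_mat TYPE(complex) n ())"

definition vst_representation :: "nat \<Rightarrow> (vst_gen word set \<Rightarrow> complex mat) \<Rightarrow> bool" where
  "vst_representation n \<Upsilon> \<longleftrightarrow> \<Upsilon> \<in> hom (VST n) (GL n)"

definition local_block :: "nat \<Rightarrow> nat \<Rightarrow> complex mat \<Rightarrow> complex mat" where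
  "local_block n i A = diag_block_mat [1\<^sub>m (i - 1), A, 1\<^sub>m (n - i - 1)]"

definition local_rep_with ::
    "nat \<Rightarrow> complex mat \<Rightarrow> complex mat \<Rightarrow> complex mat \<Rightarrow> (vst_gen word set \<Rightarrow> complex mat) \<Rightarrow> bool"
  where
  "local_rep_with n S T V \<Upsilon> \<longleftrightarrow>
    vst_representation n \<Upsilon> \<and>
    S \<in> carrier (GL 2) \<and> T \<in> carrier (GL 2) \<and> V \<in> carrier (GL 2) \<and>
    (\<forall>i\<in>{1..n - 1}.
      \<Upsilon> (vst_elem n (Sgen i)) = local_block n i S \<and>
      \<Upsilon> (vst_elem n (Tgen i)) = local_block n i T \<and>
      \<Upsilon> (vst_elem n (Vgen i)) = local_block n i V)"

definition homogeneous_2_local :: "nat \<Rightarrow> (vst_gen word set \<Rightarrow> complex mat) \<Rightarrow> bool" where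
  "homogeneous_2_local n \<Upsilon> \<longleftrightarrow> (\<exists>S T V. local_rep_with n S T V \<Upsilon>)"

definition equivalent_reps ::
    "nat \<Rightarrow> (vst_gen word set \<Rightarrow> complex mat) \<Rightarrow> (vst_gen word set \<Rightarrow> complex mat) \<Rightarrow> bool"
  where
  "equivalent_reps n \<Upsilon> \<Upsilon>' \<longleftrightarrow>
    vst_representation n \<Upsilon> \<and> vst_representation n \<Upsilon>' \<and>
    (\<exists>P\<in>carrier (GL n). \<forall>g\<in>carrier (VST n).
      \<Upsilon>' g = P \<otimes>\<^bsub>GL n\<^esub> \<Upsilon> g \<otimes>\<^bsub>GL n\<^esub> inv\<^bsub>GL n\<^esub> P)"

section \<open>The six families of blocks\<close>

abbreviation mat22 :: "complex \<Rightarrow> complex \<Rightarrow> complex \<Rightarrow> complex \<Rightarrow> complex mat" where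
  "mat22 a b c d \<equiv> mat_of_rows_list 2 [[a, b], [c, d]]"

text \<open>The parameter \<open>rt\<close> is the chosen square root function on the complex numbers.\<close>

inductive vst_blocks ::
    "(complex \<Rightarrow> complex) \<Rightarrow> nat \<Rightarrow> complex mat \<Rightarrow> complex mat \<Rightarrow> complex mat \<Rightarrow> bool"
  for rt where
  "b \<noteq> 0 \<Longrightarrow> x^2 - y^2 / b^2 \<noteq> 0 \<Longrightarrow> v \<noteq> 0 \<Longrightarrow>
    vst_blocks rt 1 (mat22 0 b (1 / b) 0) (mat22 x y (y / b^2) x) (mat22 0 v (1 / v) 0)"
| "v \<noteq> 0 \<Longrightarrow>
    vst_blocks rt 2 (mat22 (- rt (1 - b * c)) b c (rt (1 - b * c)))
      (mat22 1 0 0 1) (mat22 0 v (1 / v) 0)"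
| "v \<noteq> 0 \<Longrightarrow>
    vst_blocks rt 3 (mat22 (rt (1 - b * c)) b c (- rt (1 - b * c)))
      (mat22 1 0 0 1) (mat22 0 v (1 / v) 0)"
| "v \<noteq> 0 \<Longrightarrow>
    vst_blocks rt 4 (mat22 (-1) 0 0 (-1)) (mat22 1 0 0 1) (mat22 0 v (1 / v) 0)"
| "v \<noteq> 0 \<Longrightarrow>
    vst_blocks rt 5 (mat22 1 0 0 1) (mat22 1 0 0 1) (mat22 0 v (1 / v) 0)"
| "vst_blocks rt 6 (mat22 1 0 0 1) (mat22 1 0 0 1) (mat22 1 0 0 1)"

end

theory Submission
  imports Defs
begin

text \<open>
  Every homogeneous 2-local representation already has the blocks of one of the six families, so
  the identity matrix serves as the change of basis.

  A triple of invertible blocks \<open>S, T, V\<close> comes from a representation exactly when the defining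
  relations hold between the block diagonal matrices (the universal property of a presentation,
  \<open>presented_group_hom_iff\<close>). The number \<open>n\<close> drops out of these relations. Generators with
  distant indices act on disjoint pairs of basis vectors and commute, a relation at a single index
  is an identity between 2 by 2 matrices, and a relation at two adjacent indices takes place on
  three consecutive basis vectors, hence is the same identity between 3 by 3 matrices at every
  position. What remains is \<open>satisfy_block_relations\<close>, finitely many polynomial equations in the
  entries of the blocks; \<open>local_block_relations_iff\<close> is this reduction.

  The equations are solved separately for \<open>V\<close> and for \<open>(S, T)\<close>. An involution \<open>V\<close> with the local
  braid relation is the identity or is antidiagonal (\<open>braid_involution_scalar\<close>). For \<open>(S, T)\<close>, the
  relation \<open>s\<^sub>i s\<^sub>j \<tau>\<^sub>i = \<tau>\<^sub>j s\<^sub>i s\<^sub>j\<close> forces \<open>T = 1\<close> as soon as \<open>S\<close> has a nonzero diagonal entry, while for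
  an antidiagonal \<open>S\<close> it holds for all \<open>T\<close>, which then only has to commute with \<open>S\<close> (\<open>twin_involution_scalar\<close>).
  If \<open>V = 1\<close>, the mixed relations \<open>\<nu>\<^sub>i s\<^sub>j \<nu>\<^sub>i = \<nu>\<^sub>j s\<^sub>i \<nu>\<^sub>j\<close> and their analogue for \<open>\<tau>\<close> equate the blocks at
  two different positions, so everything is trivial; if \<open>V\<close> is antidiagonal they hold for all \<open>S\<close>
  and \<open>T\<close>, because both sides move the block onto the first and third of the three basis vectors
  with the same scaling. The solution set is thus the union of the six families, each of which
  conversely satisfies all equations.
\<close>

section \<open>Homomorphisms out of presented groups\<close>

text \<open>
  By cancellation the class of an inverse letter is the inverse of the generator, so a homomorphism
  can be evaluated letter by letter.
\<close>

lemma presented_group_hom_eval_word: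
  assumes G: "group G" and h: "h \<in> hom (presented_group X R) G" and w: "w \<in> words_over X"
  shows "h (word_class X R w) = eval_word G (\<lambda>g. h (pres_gen X R g)) w"
proof -
  let ?P = "presented_group X R"
  interpret group_hom ?P G h
    using G h by (simp add: group_hom_def group_hom_axioms_def group_presented_group)
  show ?thesis
    using w
  proof (induction w)
    case Nil
    then show ?case using hom_one by (simp add: presented_group_def)
  next
    case (Cons a w)
    obtain g e where a: "a = (g, e)" by (cases a)
    have g: "g \<in> X" and w: "w \<in> words_over X" using Cons.prems a by auto
    have "word_class X R [(g, True)] \<otimes>\<^bsub>?P\<^esub> pres_gen X R g = \<one>\<^bsub>?P\<^esub>"
      using pres_eq.cancel[OF g, of R True] g
      by (simp add: pres_gen_def pos_word_def presented_group_mult word_class_eq_iff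
          presented_group_def[THEN arg_cong[of _ _ one]])
    then have "inv\<^bsub>?P\<^esub> pres_gen X R g = word_class X R [(g, True)]"
      using g pres_gen_closed[OF g, of R]
      by (intro G.inv_equality) (simp_all add: presented_group_def)
    then have "h (word_class X R [(g, e)]) =
        (if e then inv\<^bsub>G\<^esub> h (pres_gen X R g) else h (pres_gen X R g))"
      using g hom_inv[OF pres_gen_closed[OF g, of R]] by (cases e) (auto simp: pres_gen_def pos_word_def)
    moreover have "word_class X R (a # w) = word_class X R [(g, e)] \<otimes>\<^bsub>?P\<^esub> word_class X R w"
      using presented_group_mult[of "[(g, e)]" X w R] g w a by simp
    moreover have "word_class X R u \<in> carrier ?P" if "u \<in> words_over X" for u
      using that by (simp add: presented_group_def)
    ultimately show ?case using Cons.IH[OF w] a g w by (simp add: hom_mult)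
  qed
qed

text \<open>
  One direction is the universal property. For the other, the two sides of a relation are the same
  word class, so a homomorphism cannot tell them apart.
\<close>

lemma presented_group_hom_iff:
  assumes G: "group G" and f: "\<And>g. g \<in> X \<Longrightarrow> f g \<in> carrier G"
    and R: "\<And>u v. (u, v) \<in> R \<Longrightarrow> u \<in> words_over X \<and> v \<in> words_over X"
  shows "(\<exists>h \<in> hom (presented_group X R) G. \<forall>g\<in>X. h (pres_gen X R g) = f g) \<longleftrightarrow>
    (\<forall>(u, v) \<in> R. eval_word G f u = eval_word G f v)"
proof
  assume "\<exists>h \<in> hom (presented_group X R) G. \<forall>g\<in>X. h (pres_gen X R g) = f g"
  then obtain h where h: "h \<in> hom (presented_group X R) G"
    and hf: "\<And>g. g \<in> X \<Longrightarrow> h (pres_gen X R g) = f g" by blast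
  have cong: "eval_word G (\<lambda>g. h (pres_gen X R g)) w = eval_word G f w" if "w \<in> words_over X" for w
    using that by (induction w) (auto simp: hf)
  have ev: "h (word_class X R w) = eval_word G f w" if "w \<in> words_over X" for w
    using presented_group_hom_eval_word[OF G h that] cong[OF that] by simp
  have "eval_word G f u = eval_word G f v" if "(u, v) \<in> R" for u v
  proof -
    have "word_class X R u = word_class X R v"
      using R[OF that] pres_eq.relator[OF that] by (simp add: word_class_eq_iff)
    then show ?thesis using ev R[OF that] by metis
  qed
  then show "\<forall>(u, v) \<in> R. eval_word G f u = eval_word G f v" by blast
next
  assume "\<forall>(u, v) \<in> R. eval_word G f u = eval_word G f v"
  then show "\<exists>h \<in> hom (presented_group X R) G. \<forall>g\<in>X. h (pres_gen X R g) = f g"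
    by (intro presented_group_universal G f) auto
qed

section \<open>Block diagonal matrices\<close>

lemma group_GL: "group (GL n)"
proof -
  interpret ring "ring_mat TYPE(complex) n ()" by (rule ring_mat)
  show ?thesis by (rule units_group)
qed

lemma GL_simps:
  "A \<otimes>\<^bsub>GL n\<^esub> B = A * B" "\<one>\<^bsub>GL n\<^esub> = 1\<^sub>m n"
  "A \<in> carrier (GL n) \<longleftrightarrow>
    A \<in> carrier_mat n n \<and> (\<exists>B\<in>carrier_mat n n. B * A = 1\<^sub>m n \<and> A * B = 1\<^sub>m n)"
  by (auto simp: units_of_def Units_def ring_mat_def)

lemma GL_carrier_mat: "A \<in> carrier (GL n) \<Longrightarrow> A \<in> carrier_mat n n"
  by (simp add: GL_simps)

lemma diag_block_mat_mult:
  assumes "list_all2 (\<lambda>A B. dim_col A = dim_row A \<and> dim_row B = dim_row A \<and> dim_col B = dim_row A) As Bs"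
  shows "diag_block_mat As * diag_block_mat Bs = (diag_block_mat (map2 (*) As Bs) :: 'a::semiring_1 mat)"
  using assms
proof (induction rule: list_all2_induct)
  case Nil
  then show ?case by (auto intro: eq_matI)
next
  case (Cons A As B Bs)
  then obtain k where k: "A \<in> carrier_mat k k" "B \<in> carrier_mat k k" by auto
  have "\<exists>m. diag_block_mat As \<in> carrier_mat m m \<and> diag_block_mat Bs \<in> carrier_mat m m"
    using Cons.hyps(2) unfolding carrier_mat_def
    by (induction rule: list_all2_induct) (auto simp: Let_def)
  then obtain m where m: "diag_block_mat As \<in> carrier_mat m m" "diag_block_mat Bs \<in> carrier_mat m m"
    by blast
  have d: "dim_row A = k" "dim_col A = k" "dim_row B = k" "dim_col B = k"
    "dim_row (diag_block_mat As) = m" "dim_col (diag_block_mat As) = m"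
    "dim_row (diag_block_mat Bs) = m" "dim_col (diag_block_mat Bs) = m"
    using k m by auto
  have "diag_block_mat (A # As) * diag_block_mat (B # Bs) =
      four_block_mat (A * B) (0\<^sub>m k m) (0\<^sub>m m k) (diag_block_mat As * diag_block_mat Bs)"
    using k m by (simp add: Let_def d mult_four_block_mat[OF k(1) _ _ m(1) k(2) _ _ m(2)])
  moreover have "dim_row (diag_block_mat (map2 (*) As Bs)) = m"
      "dim_col (diag_block_mat (map2 (*) As Bs)) = m"
    using d by (simp_all flip: Cons.IH)
  ultimately show ?case using Cons.IH d by (simp add: Let_def)
qed

text \<open>
  With this lemma and the next, one block diagonal matrix can be cut along different block
  patterns, which is how matrices with blocks at different positions become comparable.
\<close>

lemma diag_block_mat_flatten:
  "diag_block_mat (As @ diag_block_mat Bs # Cs) = diag_block_mat (As @ Bs @ Cs)"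
  by (induction As) (simp_all add: diag_block_mat_append Let_def)

lemma diag_block_mat_one_append:
  "diag_block_mat (As @ (1\<^sub>m (p + q) :: 'a :: semiring_1 mat) # Bs) = diag_block_mat (As @ 1\<^sub>m p # 1\<^sub>m q # Bs)"
proof -
  have "diag_block_mat [1\<^sub>m p, 1\<^sub>m q] = (1\<^sub>m (p + q) :: 'a mat)"
    by (rule eq_matI) (auto simp: Let_def)
  then show ?thesis
    using diag_block_mat_flatten[of As "[1\<^sub>m p, 1\<^sub>m q]" Bs] by simp
qed

lemma diag_block_mat_middle_inj:
  assumes "diag_block_mat [1\<^sub>m p, A, 1\<^sub>m q] = diag_block_mat [1\<^sub>m p, B, 1\<^sub>m q]"
    and "A \<in> carrier_mat k k" "B \<in> carrier_mat k k"
  shows "A = B"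
proof (rule eq_matI)
  fix i j assume "i < dim_row B" "j < dim_col B"
  then show "A $$ (i, j) = B $$ (i, j)"
    using arg_cong[OF assms(1), of "\<lambda>M. M $$ (p + i, p + j)"] assms(2,3) by (simp add: Let_def)
qed (use assms in auto)

section \<open>The relations between the blocks\<close>

abbreviation mat33 ::
    "complex \<Rightarrow> complex \<Rightarrow> complex \<Rightarrow> complex \<Rightarrow> complex \<Rightarrow> complex \<Rightarrow> complex \<Rightarrow> complex \<Rightarrow>
      complex \<Rightarrow> complex mat" where
  "mat33 a b c d e f g h k \<equiv> mat_of_rows_list 3 [[a, b, c], [d, e, f], [g, h, k]]"

lemma mat22_carrier [simp]: "mat22 a b c d \<in> carrier_mat 2 2"
  by (simp add: mat_of_rows_list_def numeral_2_eq_2)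

lemma mat22_exhaust:
  assumes "A \<in> carrier_mat 2 2"
  obtains a b c d where "A = mat22 a b c d"
proof
  show "A = mat22 (A $$ (0, 0)) (A $$ (0, 1)) (A $$ (1, 0)) (A $$ (1, 1))"
    using assms by (intro eq_matI) (auto simp: mat_of_rows_list_def less_Suc_eq numeral_2_eq_2)
qed

lemma mat22_eq_iff:
  "mat22 a b c d = mat22 a' b' c' d' \<longleftrightarrow> a = a' \<and> b = b' \<and> c = c' \<and> d = d'"
  by (auto simp: mat_of_rows_list_def mat_eq_iff less_Suc_eq numeral_2_eq_2)

lemma mat22_mult:
  "mat22 a b c d * mat22 a' b' c' d' =
    mat22 (a * a' + b * c') (a * b' + b * d') (c * a' + d * c') (c * b' + d * d')"
  by (rule eq_matI) (auto simp: mat_of_rows_list_def less_Suc_eq numeral_2_eq_2 scalar_prod_def)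

lemma one_mat_2: "1\<^sub>m 2 = mat22 1 0 0 1"
  by (rule eq_matI) (auto simp: mat_of_rows_list_def less_Suc_eq numeral_2_eq_2)

lemma mat33_eq_iff:
  "mat33 a b c d e f g h k = mat33 a' b' c' d' e' f' g' h' k' \<longleftrightarrow>
    a = a' \<and> b = b' \<and> c = c' \<and> d = d' \<and> e = e' \<and> f = f' \<and> g = g' \<and> h = h' \<and> k = k'"
  by (auto simp: mat_of_rows_list_def mat_eq_iff less_Suc_eq numeral_3_eq_3)

lemma mat33_mult:
  "mat33 a b c d e f g h k * mat33 a' b' c' d' e' f' g' h' k' =
    mat33 (a * a' + b * d' + c * g') (a * b' + b * e' + c * h') (a * c' + b * f' + c * k')
      (d * a' + e * d' + f * g') (d * b' + e * e' + f * h') (d * c' + e * f' + f * k')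
      (g * a' + h * d' + k * g') (g * b' + h * e' + k * h') (g * c' + h * f' + k * k')"
  by (rule eq_matI) (auto simp: mat_of_rows_list_def less_Suc_eq numeral_3_eq_3 scalar_prod_def)

lemma local_block_3:
  "local_block 3 1 (mat22 a b c d) = mat33 a b 0 c d 0 0 0 1"
  "local_block 3 2 (mat22 a b c d) = mat33 1 0 0 0 a b 0 c d"
  by (rule eq_matI; auto simp: local_block_def mat_of_rows_list_def less_Suc_eq
      numeral_3_eq_3 numeral_2_eq_2 Let_def)+

text \<open>
  Every relation between adjacent indices compares two products of this shape. The products are
  kept in simplified form so that the scalar equations come out short.
\<close>

lemma local_block_3_triple:
  "local_block 3 1 (mat22 a b c d) * (local_block 3 2 (mat22 e f g h) * local_block 3 1 (mat22 x y z w)) =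
    mat33 (a * x + b * e * z) (a * y + b * e * w) (b * f)
      (c * x + d * e * z) (c * y + d * e * w) (d * f) (g * z) (g * w) h"
  "local_block 3 2 (mat22 a b c d) * (local_block 3 1 (mat22 e f g h) * local_block 3 2 (mat22 x y z w)) =
    mat33 e (f * x) (f * y) (a * g) (a * h * x + b * z) (a * h * y + b * w)
      (c * g) (c * h * x + d * z) (c * h * y + d * w)"
  by (simp_all add: local_block_3[unfolded One_nat_def] mat33_mult mat33_eq_iff algebra_simps)

text \<open>The explicit inverse is the adjugate divided by the determinant.\<close>

lemma mat22_GL_iff: "mat22 a b c d \<in> carrier (GL 2) \<longleftrightarrow> a * d - b * c \<noteq> 0"
proof
  assume "mat22 a b c d \<in> carrier (GL 2)"
  then obtain B where "B \<in> carrier_mat 2 2" and AB: "mat22 a b c d * B = 1\<^sub>m 2"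
    by (auto simp: GL_simps)
  then obtain e f g h where "B = mat22 e f g h" by (elim mat22_exhaust)
  with AB have "a * e + b * g = 1" "a * f + b * h = 0" "c * e + d * g = 0" "c * f + d * h = 1"
    by (auto simp: mat22_mult one_mat_2 mat22_eq_iff)
  moreover have "(a * d - b * c) * (e * h - f * g) =
      (a * e + b * g) * (c * f + d * h) - (a * f + b * h) * (c * e + d * g)"
    by (simp add: algebra_simps)
  ultimately have "(a * d - b * c) * (e * h - f * g) = 1" by simp
  then show "a * d - b * c \<noteq> 0" by auto
next
  assume det: "a * d - b * c \<noteq> 0"
  let ?D = "a * d - b * c"
  let ?B = "mat22 (d / ?D) (- b / ?D) (- c / ?D) (a / ?D)"
  have "?B * mat22 a b c d = 1\<^sub>m 2" "mat22 a b c d * ?B = 1\<^sub>m 2"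
    using det by (auto simp: mat22_mult one_mat_2 mat22_eq_iff add_divide_distrib[symmetric]
        diff_divide_distrib[symmetric] mult.commute)
  then show "mat22 a b c d \<in> carrier (GL 2)"
    unfolding GL_simps using mat22_carrier by blast
qed

text \<open>
  Of the relations of the group for \<open>n = 3\<close>, the one-index ones are stated on the blocks
  themselves; three strands suffice to see every relation between adjacent indices, in both orders.
\<close>

definition satisfy_block_relations :: "complex mat \<Rightarrow> complex mat \<Rightarrow> complex mat \<Rightarrow> bool" where
  "satisfy_block_relations S T V \<longleftrightarrow>
    S * S = 1\<^sub>m 2 \<and> V * V = 1\<^sub>m 2 \<and> T * S = S * T \<and>
    (\<forall>(i, j) \<in> {(1, 2), (2, 1)}. let L = local_block 3 in
      L i S * (L j S * L i T) = L j T * (L i S * L j S) \<and>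
      L i V * (L j V * L i V) = L j V * (L i V * L j V) \<and>
      L i V * (L j S * L i V) = L j V * (L i S * L j V) \<and>
      L i V * (L j T * L i V) = L j V * (L i T * L j V))"

text \<open>
  The off-diagonal entries of the braid relation give \<open>p q s = p r s = 0\<close>. If \<open>p\<close> is nonzero, so is
  \<open>s\<close>, since \<open>s = 0\<close> would force \<open>q r = 1\<close> and then \<open>p\<^sup>2 = 0\<close>; hence the matrix is diagonal and the
  equations \<open>p\<^sup>2 = p\<close> and \<open>s\<^sup>2 = s\<close> make it the identity. If \<open>p = 0\<close>, being an involution leaves
  only the antidiagonal form.
\<close>

lemma braid_involution_scalar:
  fixes p q r s :: complex
  assumes inv: "p * p + q * r = 1" "r * q + s * s = 1" "p * q + q * s = 0" "r * p + s * r = 0"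
    and braid: "p * q + q * p * s = q * p" "r * p + s * p * r = p * r"
      "p * p + q * p * r = p" "s = r * s * q + s * s"
  shows "(p = 1 \<and> q = 0 \<and> r = 0 \<and> s = 1) \<or> (p = 0 \<and> s = 0 \<and> q \<noteq> 0 \<and> r = 1 / q)"
proof (cases "p = 0")
  case True
  then have "q * r = 1" "s = 0" using inv by (auto simp: mult.commute)
  then show ?thesis using True by (auto simp: eq_divide_eq mult.commute)
next
  case False
  then have "s \<noteq> 0" using inv by (auto simp: mult.commute)
  moreover have "q * p * s = 0" "r * p * s = 0" using braid by (simp_all add: mult_ac)
  ultimately have qr: "q = 0" "r = 0" using False by auto
  then show ?thesis using braid False \<open>s \<noteq> 0\<close> by simp
qed

text \<open>
  Since \<open>S\<close> is an involution, \<open>a\<^sup>2 = d\<^sup>2\<close>, so both diagonal entries of \<open>S\<close> vanish or neither does. In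
  the first case only commutation with \<open>S\<close> restricts \<open>T\<close>. In the second, the relation between
  adjacent indices yields \<open>a d z = a d y = 0\<close> and then \<open>x = w = 1\<close>; either \<open>S\<close> has trace zero or
  its off-diagonal entries are annihilated by \<open>a + d = 2 a\<close> and \<open>S\<close> is 1 or -1.
\<close>

lemma twin_involution_scalar:
  fixes a b c d x y z w :: complex
  assumes inv: "a * a + b * c = 1" "c * b + d * d = 1" "a * b + b * d = 0" "c * a + d * c = 0"
    and comm: "x * a + y * c = a * x + b * z" "x * b + y * d = a * y + b * w"
    and rel: "a * x + b * a * z = a" "c * x + d * a * z = x * c" "b * x = x * b + y * a * d"
      "d = z * d * b + w * d"
  shows "(a = 0 \<and> d = 0 \<and> b \<noteq> 0 \<and> c = 1 / b \<and> w = x \<and> z = y / b\<^sup>2) \<or>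
    (x = 1 \<and> y = 0 \<and> z = 0 \<and> w = 1 \<and>
      (d = - a \<or> (b = 0 \<and> c = 0 \<and> a = d \<and> (a = 1 \<or> a = - 1))))"
proof (cases "a = 0")
  case True
  then have "d = 0" and bc: "b * c = 1" using inv by (auto simp: mult.commute)
  then have "b \<noteq> 0" "c = 1 / b" by (auto simp: eq_divide_eq mult.commute)
  moreover have "w = x"
    using comm True \<open>d = 0\<close> \<open>b \<noteq> 0\<close> by (simp add: mult.commute)
  moreover have "z = y / b\<^sup>2"
  proof -
    have "y * c = b * z" using comm True by simp
    then have "y / b / b = z" using \<open>c = 1 / b\<close> \<open>b \<noteq> 0\<close> by simp
    then show ?thesis by (simp add: power2_eq_square)
  qed
  ultimately show ?thesis using True \<open>d = 0\<close> by simp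
next
  case False
  have "c * b = b * c" by (rule mult.commute)
  with inv(1,2) have "d * d = a * a" by (metis add.commute add_right_cancel)
  then have d: "d = a \<or> d = - a" by (simp add: square_eq_iff)
  with False have "d \<noteq> 0" by auto
  have "d * a * z = 0" "y * a * d = 0" using rel(2,3) by (simp_all add: mult.commute)
  with False \<open>d \<noteq> 0\<close> have yz: "y = 0" "z = 0" by auto
  with rel(1,4) False \<open>d \<noteq> 0\<close> have xw: "x = 1" "w = 1" by auto
  show ?thesis
  proof (cases "d = - a")
    case False
    with d have "d = a" by simp
    then have "b = 0" "c = 0" using inv(3,4) \<open>a \<noteq> 0\<close> by (auto simp: mult.commute)
    then show ?thesis using yz xw inv(1) \<open>d = a\<close> by (auto simp: square_eq_1_iff)
  qed (use yz xw in simp)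
qed

lemma satisfy_block_relations_imp_vst_blocks:
  assumes rel: "satisfy_block_relations S T V"
    and GL: "S \<in> carrier (GL 2)" "T \<in> carrier (GL 2)" "V \<in> carrier (GL 2)"
    and rt: "\<And>z. (rt z)\<^sup>2 = z"
  shows "\<exists>j. vst_blocks rt j S T V"
proof -
  obtain a b c d x y z w p q r s where S: "S = mat22 a b c d" and T: "T = mat22 x y z w"
    and V: "V = mat22 p q r s"
    using GL[THEN GL_carrier_mat] by (elim mat22_exhaust)
  note eqs = rel[unfolded satisfy_block_relations_def S T V Let_def, simplified,
      unfolded local_block_3_triple[unfolded One_nat_def] mat22_mult one_mat_2 mat22_eq_iff mat33_eq_iff]
  have "(p = 1 \<and> q = 0 \<and> r = 0 \<and> s = 1) \<or> (p = 0 \<and> s = 0 \<and> q \<noteq> 0 \<and> r = 1 / q)"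
    by (rule braid_involution_scalar; use eqs in \<open>elim conjE\<close>)
  moreover have "(a = 0 \<and> d = 0 \<and> b \<noteq> 0 \<and> c = 1 / b \<and> w = x \<and> z = y / b\<^sup>2) \<or>
    (x = 1 \<and> y = 0 \<and> z = 0 \<and> w = 1 \<and>
      (d = - a \<or> (b = 0 \<and> c = 0 \<and> a = d \<and> (a = 1 \<or> a = - 1))))"
    by (rule twin_involution_scalar; use eqs in \<open>elim conjE\<close>)
  \<comment> \<open>With \<open>V = 1\<close> the mixed relations put the blocks at both positions equal.\<close>
  moreover have "a = 1 \<and> b = 0 \<and> c = 0 \<and> d = 1 \<and> x = 1 \<and> y = 0 \<and> z = 0 \<and> w = 1"
    if "p = 1 \<and> q = 0 \<and> r = 0 \<and> s = 1"
    using eqs that by simp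
  moreover have "x\<^sup>2 - y\<^sup>2 / b\<^sup>2 \<noteq> 0" if "w = x" "z = y / b\<^sup>2"
    using GL(2) that by (simp add: T mat22_GL_iff power2_eq_square)
  \<comment> \<open>The chosen root may have either sign, which is what separates the second and third family.\<close>
  moreover have "d = rt (1 - b * c) \<or> d = - rt (1 - b * c)"
  proof -
    have "c * b + d * d = 1" using eqs by (elim conjE)
    then have "d\<^sup>2 = (rt (1 - b * c))\<^sup>2" unfolding rt by (simp add: power2_eq_square algebra_simps)
    then show ?thesis by (simp add: power2_eq_iff)
  qed
  ultimately consider
      (trivial) "S = mat22 1 0 0 1" "T = mat22 1 0 0 1" "V = mat22 1 0 0 1"
    | (twin) "b \<noteq> 0" "x\<^sup>2 - y\<^sup>2 / b\<^sup>2 \<noteq> 0" "q \<noteq> 0" "S = mat22 0 b (1 / b) 0"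
        "T = mat22 x y (y / b\<^sup>2) x" "V = mat22 0 q (1 / q) 0"
    | (neg_root) "q \<noteq> 0" "S = mat22 (- rt (1 - b * c)) b c (rt (1 - b * c))"
        "T = mat22 1 0 0 1" "V = mat22 0 q (1 / q) 0"
    | (pos_root) "q \<noteq> 0" "S = mat22 (rt (1 - b * c)) b c (- rt (1 - b * c))"
        "T = mat22 1 0 0 1" "V = mat22 0 q (1 / q) 0"
    | (scalar) "q \<noteq> 0" "S = mat22 1 0 0 1 \<or> S = mat22 (-1) 0 0 (-1)"
        "T = mat22 1 0 0 1" "V = mat22 0 q (1 / q) 0"
    unfolding S T V mat22_eq_iff by (smt (verit, ccfv_threshold) minus_equation_iff)
  then show ?thesis
    by cases (use vst_blocks.intros in \<open>metis\<close>)+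
qed

lemma vst_blocks_GL:
  assumes "vst_blocks rt j S T V" and rt: "\<And>z. (rt z)\<^sup>2 = z"
  shows "S \<in> carrier (GL 2)" "T \<in> carrier (GL 2)" "V \<in> carrier (GL 2)"
  using assms(1) rt
  by (cases; simp add: mat22_GL_iff power2_eq_square)+

lemma vst_blocks_imp_satisfy_block_relations:
  assumes "vst_blocks rt j S T V" and rt: "\<And>z. (rt z)\<^sup>2 = z"
  shows "satisfy_block_relations S T V"
  using assms(1) rt
  by cases
    (simp_all add: satisfy_block_relations_def Let_def local_block_3[unfolded One_nat_def] mat22_mult
      mat33_mult one_mat_2 mat22_eq_iff mat33_eq_iff field_simps flip: power2_eq_square)

lemma vst_blocks_index: "vst_blocks rt j S T V \<Longrightarrow> j \<in> {1..6}"
  by (cases rule: vst_blocks.cases) auto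

section \<open>Reduction of the group relations to three strands\<close>

fun vst_local_block ::
    "nat \<Rightarrow> complex mat \<Rightarrow> complex mat \<Rightarrow> complex mat \<Rightarrow> vst_gen \<Rightarrow> complex mat" where
  "vst_local_block n S T V (Sgen i) = local_block n i S"
| "vst_local_block n S T V (Tgen i) = local_block n i T"
| "vst_local_block n S T V (Vgen i) = local_block n i V"

lemma vst_rels_words:
  "(u, v) \<in> vst_rels n \<Longrightarrow> u \<in> words_over (vst_gens n) \<and> v \<in> words_over (vst_gens n)"
  by (cases rule: vst_rels.cases) (auto simp: pos_word_def vst_gens_def)

lemma local_block_carrier:
  "A \<in> carrier_mat 2 2 \<Longrightarrow> i \<in> {1..n - 1} \<Longrightarrow> local_block n i A \<in> carrier_mat n n"
  by (auto simp: local_block_def Let_def)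

lemma local_block_mult:
  "A \<in> carrier_mat 2 2 \<Longrightarrow> B \<in> carrier_mat 2 2 \<Longrightarrow>
    local_block n i A * local_block n i B = local_block n i (A * B)"
  unfolding local_block_def by (subst diag_block_mat_mult) auto

lemma local_block_one: "i \<in> {1..n - 1} \<Longrightarrow> local_block n i (1\<^sub>m 2) = 1\<^sub>m n"
  unfolding local_block_def by (rule eq_matI) (auto simp: Let_def)

lemma local_block_inj:
  "local_block n i A = local_block n i B \<Longrightarrow> A \<in> carrier_mat 2 2 \<Longrightarrow> B \<in> carrier_mat 2 2 \<Longrightarrow> A = B"
  unfolding local_block_def by (rule diag_block_mat_middle_inj)

lemma local_block_GL:
  assumes A: "A \<in> carrier (GL 2)" and i: "i \<in> {1..n - 1}"
  shows "local_block n i A \<in> carrier (GL n)"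
proof -
  obtain B where AB: "A \<in> carrier_mat 2 2" "B \<in> carrier_mat 2 2" "B * A = 1\<^sub>m 2" "A * B = 1\<^sub>m 2"
    using A by (auto simp: GL_simps)
  then have "local_block n i B * local_block n i A = 1\<^sub>m n" "local_block n i A * local_block n i B = 1\<^sub>m n"
    using i by (simp_all add: local_block_mult local_block_one)
  then show ?thesis
    using local_block_carrier[OF AB(1) i] local_block_carrier[OF AB(2) i] by (auto simp: GL_simps)
qed

text \<open>
  Both matrices are cut along the common pattern of sizes \<open>i - 1\<close>, 2, \<open>j - i - 2\<close>, 2, \<open>n - j - 1\<close>
  (for \<open>i < j\<close>), where in each diagonal block one of the two factors is the identity.
\<close>

lemma local_block_distant_commute:
  assumes "A \<in> carrier_mat 2 2" "B \<in> carrier_mat 2 2" "distant n i j"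
  shows "local_block n i A * local_block n j B = local_block n j B * local_block n i A"
proof -
  have *: "local_block n i A * local_block n j B = local_block n j B * local_block n i A"
    if ij: "1 \<le> i" "i + 2 \<le> j" "j < n" and AB: "A \<in> carrier_mat 2 2" "B \<in> carrier_mat 2 2"
    for A B i j
  proof -
    define p r q where "p = i - 1" and "r = j - i - 2" and "q = n - j - 1"
    have i: "i - 1 = p" "n - i - 1 = r + (2 + q)" and j: "j - 1 = p + (2 + r)" "n - j - 1 = q"
      using ij by (auto simp: p_def r_def q_def)
    have "local_block n i A = diag_block_mat [1\<^sub>m p, A, 1\<^sub>m r, 1\<^sub>m 2, 1\<^sub>m q]"
      using diag_block_mat_one_append[of "[1\<^sub>m p, A]" r "2 + q" "[]"]
        diag_block_mat_one_append[of "[1\<^sub>m p, A, 1\<^sub>m r]" 2 q "[]"]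
      by (simp only: local_block_def i append.simps)
    moreover have "local_block n j B = diag_block_mat [1\<^sub>m p, 1\<^sub>m 2, 1\<^sub>m r, B, 1\<^sub>m q]"
      using diag_block_mat_one_append[of "[]" p "2 + r" "[B, 1\<^sub>m q]"]
        diag_block_mat_one_append[of "[1\<^sub>m p]" 2 r "[B, 1\<^sub>m q]"]
      by (simp only: local_block_def j append.simps)
    ultimately show ?thesis
      using AB by (auto simp: diag_block_mat_mult simp del: diag_block_mat.simps)
  qed
  show ?thesis
  proof (cases "i < j")
    case True
    then show ?thesis using assms by (intro *) auto
  next
    case False
    then show ?thesis using assms by (intro *[symmetric]) auto
  qed
qed

text \<open>
  The first of two adjacent indices corresponds to position 1 and the second to position 2 in
  one and the same 3 by 3 block, which starts after \<open>m\<close> basis vectors.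
\<close>

lemma local_block_embed_3:
  assumes "A \<in> carrier_mat 2 2" "k \<in> {1, 2}"
  shows "local_block (m + 3 + q) (m + k) A = diag_block_mat [1\<^sub>m m, local_block 3 k A, 1\<^sub>m q]"
proof -
  have "diag_block_mat [1\<^sub>m m, local_block 3 k A, 1\<^sub>m q] =
      diag_block_mat [1\<^sub>m m, 1\<^sub>m (k - 1), A, 1\<^sub>m (2 - k), 1\<^sub>m q]"
    using diag_block_mat_flatten[of "[1\<^sub>m m]" "[1\<^sub>m (k - 1), A, 1\<^sub>m (2 - k)]" "[1\<^sub>m q]"]
    by (simp add: local_block_def del: diag_block_mat.simps)
  also have "\<dots> = diag_block_mat [1\<^sub>m (m + (k - 1)), A, 1\<^sub>m (2 - k + q)]"
    using diag_block_mat_one_append[of "[]" m "k - 1" "[A, 1\<^sub>m (2 - k), 1\<^sub>m q]"]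
      diag_block_mat_one_append[of "[1\<^sub>m (m + (k - 1)), A]" "2 - k" q "[]"]
    by (simp del: diag_block_mat.simps)
  also have "\<dots> = local_block (m + 3 + q) (m + k) A"
  proof -
    have "m + (k - 1) = m + k - 1" "2 - k + q = m + 3 + q - (m + k) - 1" using assms(2) by auto
    then show ?thesis by (simp only: local_block_def)
  qed
  finally show ?thesis by (simp only:)
qed

lemma local_block_triple_embed_3:
  assumes "A \<in> carrier_mat 2 2" "B \<in> carrier_mat 2 2" "C \<in> carrier_mat 2 2"
    and "i \<in> {1, 2}" "j \<in> {1, 2}" "k \<in> {1, 2}"
  shows "local_block (m + 3 + q) (m + i) A *
      (local_block (m + 3 + q) (m + j) B * local_block (m + 3 + q) (m + k) C) =
    diag_block_mat [1\<^sub>m m, local_block 3 i A * (local_block 3 j B * local_block 3 k C), 1\<^sub>m q]"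
proof -
  have c: "local_block 3 l M \<in> carrier_mat 3 3" if "l \<in> {1, 2}" "M \<in> carrier_mat 2 2" for l M
    using that by (intro local_block_carrier) auto
  note cs = c[OF assms(4,1), THEN carrier_matD(1)] c[OF assms(4,1), THEN carrier_matD(2)]
    c[OF assms(5,2), THEN carrier_matD(1)] c[OF assms(5,2), THEN carrier_matD(2)]
    c[OF assms(6,3), THEN carrier_matD(1)] c[OF assms(6,3), THEN carrier_matD(2)]
  show ?thesis
    using assms by (simp only: local_block_embed_3) (simp add: diag_block_mat_mult cs del: diag_block_mat.simps)
qed

text \<open>
  Both directions are used: from \<open>n\<close> to three strands to extract equations from a
  representation, and back to build one.
\<close>

lemma local_block_triple_eq_iff:
  assumes "A \<in> carrier_mat 2 2" "B \<in> carrier_mat 2 2" "C \<in> carrier_mat 2 2"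
    and "A' \<in> carrier_mat 2 2" "B' \<in> carrier_mat 2 2" "C' \<in> carrier_mat 2 2"
    and ij: "i \<in> {1, 2}" "j \<in> {1, 2}"
  shows "local_block (m + 3 + q) (m + i) A *
      (local_block (m + 3 + q) (m + j) B * local_block (m + 3 + q) (m + i) C) =
    local_block (m + 3 + q) (m + j) A' *
      (local_block (m + 3 + q) (m + i) B' * local_block (m + 3 + q) (m + j) C') \<longleftrightarrow>
    local_block 3 i A * (local_block 3 j B * local_block 3 i C) =
    local_block 3 j A' * (local_block 3 i B' * local_block 3 j C')"
proof -
  have c: "local_block 3 l M \<in> carrier_mat 3 3" if "l \<in> {1, 2}" "M \<in> carrier_mat 2 2" for l M
    using that by (intro local_block_carrier) auto
  have "local_block 3 i A * (local_block 3 j B * local_block 3 i C) \<in> carrier_mat 3 3"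
    "local_block 3 j A' * (local_block 3 i B' * local_block 3 j C') \<in> carrier_mat 3 3"
    using assms by (auto intro!: mult_carrier_mat[of _ 3 3] c)
  then show ?thesis
    using assms by (simp only: local_block_triple_embed_3) (metis diag_block_mat_middle_inj)
qed

lemma eval_pos_word:
  "f g \<in> carrier_mat n n \<Longrightarrow> eval_word (GL n) f (pos_word [g]) = f g"
  "eval_word (GL n) f (pos_word (g # g' # gs)) = f g * eval_word (GL n) f (pos_word (g' # gs))"
  by (simp_all add: pos_word_def GL_simps)

lemma local_block_relations_iff:
  assumes n: "n \<ge> 3"
    and c: "S \<in> carrier_mat 2 2" "T \<in> carrier_mat 2 2" "V \<in> carrier_mat 2 2"
  shows "(\<forall>(u, v) \<in> vst_rels n. eval_word (GL n) (vst_local_block n S T V) u =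
      eval_word (GL n) (vst_local_block n S T V) v) \<longleftrightarrow> satisfy_block_relations S T V"
    (is "?rels \<longleftrightarrow> _")
proof -
  let ?ev = "eval_word (GL n) (vst_local_block n S T V)"
  \<comment> \<open>\<open>((A, B, C), (A', B', C'))\<close> encodes the relation \<open>A\<^sub>i B\<^sub>j C\<^sub>i = A'\<^sub>j B'\<^sub>i C'\<^sub>j\<close> for adjacent \<open>i, j\<close>.\<close>
  let ?triples = "{((S, S, T), (T, S, S)), ((V, V, V), (V, V, V)), ((V, S, V), (V, S, V)),
    ((V, T, V), (V, T, V))}"
  note ev = eval_pos_word GL_simps(2) local_block_carrier c
  show ?thesis
  proof
    assume ?rels
    then have rel: "?ev u = ?ev v" if "(u, v) \<in> vst_rels n" for u v
      using that by blast
    \<comment> \<open>The relations at the indices 1 and 2 suffice; no basis vectors precede their block, hence the 0.\<close>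
    define q where "q = n - 3"
    have n: "n = 0 + 3 + q" using n by (simp add: q_def)
    have "local_block n 1 S * local_block n 1 S = 1\<^sub>m n"
      using rel[OF vst_rels.intros(1)[of 1 n]] n by (simp add: ev)
    then have "local_block n 1 (S * S) = local_block n 1 (1\<^sub>m 2)"
      using n c by (simp add: local_block_mult local_block_one)
    then have SS: "S * S = 1\<^sub>m 2"
      using c by (elim local_block_inj) auto
    have "local_block n 1 V * local_block n 1 V = 1\<^sub>m n"
      using rel[OF vst_rels.intros(2)[of 1 n]] n by (simp add: ev)
    then have "local_block n 1 (V * V) = local_block n 1 (1\<^sub>m 2)"
      using n c by (simp add: local_block_mult local_block_one)
    then have VV: "V * V = 1\<^sub>m 2"
      using c by (elim local_block_inj) auto
    have "local_block n 1 T * local_block n 1 S = local_block n 1 S * local_block n 1 T"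
      using rel[OF vst_rels.intros(3)[of 1 n]] n by (simp add: ev)
    then have "local_block n 1 (T * S) = local_block n 1 (S * T)"
      using c by (simp add: local_block_mult)
    then have TS: "T * S = S * T"
      using c by (elim local_block_inj) auto
    have "local_block 3 i A * (local_block 3 j B * local_block 3 i C) =
        local_block 3 j A' * (local_block 3 i B' * local_block 3 j C')"
      if "(i, j) = (1, 2) \<or> (i, j) = (2, 1)" and ABC: "((A, B, C), (A', B', C')) \<in> ?triples"
      for i j A B C A' B' C'
    proof -
      have "adjacent n i j" using that(1) n by auto
      note r = vst_rels.intros(4-7)[OF this, THEN rel]
      have ij: "i \<in> {1..n - 1}" "j \<in> {1..n - 1}" "i \<in> {1,2}" "j \<in> {1,2}" using that(1) n by auto
      have "local_block n i A * (local_block n j B * local_block n i C) =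
          local_block n j A' * (local_block n i B' * local_block n j C')"
        using ABC r[simplified ev ij] ij by (auto simp: ev)
      then show ?thesis
        using local_block_triple_eq_iff[of A B C A' B' C' i j 0 q] c that(2) ij n by auto
    qed
    then show "satisfy_block_relations S T V"
      using SS VV TS by (auto simp: satisfy_block_relations_def)
  next
    assume R: "satisfy_block_relations S T V"
    have adj: "local_block n i A * (local_block n j B * local_block n i C) =
          local_block n j A' * (local_block n i B' * local_block n j C')"
      if a: "adjacent n i j" and ABC: "((A, B, C), (A', B', C')) \<in> ?triples"
      for i j A B C A' B' C'
    proof -
      define m where "m = min i j - 1"
      define q where "q = n - 3 - m"
      define k l where "k = i - m" and "l = j - m"
      have eqs: "i = m + k" "j = m + l" "n = m + 3 + q" "(k, l) = (1, 2) \<or> (k, l) = (2, 1)"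
        using a n by (auto simp: m_def q_def k_def l_def)
      have "local_block 3 k A * (local_block 3 l B * local_block 3 k C) =
          local_block 3 l A' * (local_block 3 k B' * local_block 3 l C')"
        using R eqs(4) ABC by (auto simp: satisfy_block_relations_def Let_def)
      then show ?thesis
        unfolding eqs(1-3) using eqs(4) ABC c by (subst local_block_triple_eq_iff) auto
    qed
    have "?ev u = ?ev v" if "(u, v) \<in> vst_rels n" for u v
      using that
    proof (cases rule: vst_rels.cases)
      case (8 i j g h)
      obtain A where A: "A \<in> carrier_mat 2 2" "vst_local_block n S T V (g i) = local_block n i A"
        using 8 c by auto
      obtain B where B: "B \<in> carrier_mat 2 2" "vst_local_block n S T V (h j) = local_block n j B"
        using 8 c by auto
      show ?thesis
        using local_block_distant_commute[of A B i n j] A B 8 by (simp add: ev)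
    qed (use R c adj in \<open>auto simp: ev satisfy_block_relations_def local_block_mult local_block_one\<close>)
    then show ?rels by blast
  qed
qed

section \<open>The classification\<close>

lemma ex_local_rep_with_iff:
  assumes n: "n \<ge> 3" and GL: "S \<in> carrier (GL 2)" "T \<in> carrier (GL 2)" "V \<in> carrier (GL 2)"
  shows "(\<exists>\<Upsilon>. local_rep_with n S T V \<Upsilon>) \<longleftrightarrow> satisfy_block_relations S T V"
proof -
  let ?f = "vst_local_block n S T V"
  have "local_rep_with n S T V \<Upsilon> \<longleftrightarrow>
      \<Upsilon> \<in> hom (VST n) (GL n) \<and> (\<forall>g\<in>vst_gens n. \<Upsilon> (vst_elem n g) = ?f g)" for \<Upsilon>
    using GL by (auto simp: local_rep_with_def vst_representation_def vst_gens_def)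
  then have "(\<exists>\<Upsilon>. local_rep_with n S T V \<Upsilon>) \<longleftrightarrow>
      (\<exists>\<Upsilon> \<in> hom (VST n) (GL n). \<forall>g\<in>vst_gens n. \<Upsilon> (vst_elem n g) = ?f g)"
    by blast
  also have "\<dots> \<longleftrightarrow> (\<forall>(u, v) \<in> vst_rels n. eval_word (GL n) ?f u = eval_word (GL n) ?f v)"
    unfolding VST_def vst_elem_def
  proof (rule presented_group_hom_iff[OF group_GL])
    show "?f g \<in> carrier (GL n)" if "g \<in> vst_gens n" for g
      using that GL by (auto simp: vst_gens_def local_block_GL)
  qed (rule vst_rels_words)
  also have "\<dots> \<longleftrightarrow> satisfy_block_relations S T V"
    using GL[THEN GL_carrier_mat] by (rule local_block_relations_iff[OF n])
  finally show ?thesis .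
qed

lemma equivalent_reps_refl:
  assumes "vst_representation n \<Upsilon>"
  shows "equivalent_reps n \<Upsilon> \<Upsilon>"
proof -
  interpret group "GL n" by (rule group_GL)
  have "\<Upsilon> g = \<one>\<^bsub>GL n\<^esub> \<otimes>\<^bsub>GL n\<^esub> \<Upsilon> g \<otimes>\<^bsub>GL n\<^esub> inv\<^bsub>GL n\<^esub> \<one>\<^bsub>GL n\<^esub>"
    if "g \<in> carrier (VST n)" for g
  proof -
    have "\<Upsilon> g \<in> carrier (GL n)"
      using assms that by (auto simp: vst_representation_def hom_def)
    then show ?thesis by simp
  qed
  then show ?thesis
    using assms one_closed unfolding equivalent_reps_def by blast
qed

theorem theorem21:
  fixes n :: nat and \<Upsilon> :: "vst_gen word set \<Rightarrow> complex mat" and rt :: "complex \<Rightarrow> complex"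
  assumes "n \<ge> 3"
    and "\<And>z. (rt z)^2 = z"
    and "homogeneous_2_local n \<Upsilon>"
  shows "(\<forall>j\<in>{1..6}. \<forall>S T V. vst_blocks rt j S T V \<longrightarrow> (\<exists>\<Upsilon>'. local_rep_with n S T V \<Upsilon>')) \<and>
    (\<exists>j\<in>{1..6}. \<exists>S T V \<Upsilon>'. vst_blocks rt j S T V \<and> local_rep_with n S T V \<Upsilon>' \<and>
      equivalent_reps n \<Upsilon> \<Upsilon>')"
proof (intro conjI ballI allI impI)
  fix j S T V assume blocks: "vst_blocks rt j S T V"
  show "\<exists>\<Upsilon>'. local_rep_with n S T V \<Upsilon>'"
    using vst_blocks_imp_satisfy_block_relations[OF blocks assms(2)]
      ex_local_rep_with_iff[OF assms(1) vst_blocks_GL[OF blocks assms(2)]] by blast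
next
  obtain S T V where rep: "local_rep_with n S T V \<Upsilon>"
    using assms(3) by (auto simp: homogeneous_2_local_def)
  then have GL: "S \<in> carrier (GL 2)" "T \<in> carrier (GL 2)" "V \<in> carrier (GL 2)"
    and hom: "vst_representation n \<Upsilon>"
    by (auto simp: local_rep_with_def)
  have "satisfy_block_relations S T V"
    using ex_local_rep_with_iff[OF assms(1) GL] rep by blast
  then obtain j where "vst_blocks rt j S T V"
    using satisfy_block_relations_imp_vst_blocks[OF _ GL assms(2)] by blast
  then show "\<exists>j\<in>{1..6}. \<exists>S T V \<Upsilon>'. vst_blocks rt j S T V \<and> local_rep_with n S T V \<Upsilon>' \<and>
      equivalent_reps n \<Upsilon> \<Upsilon>'"
    using rep equivalent_reps_refl[OF hom] vst_blocks_index by blast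
qed

end
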